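(* Let $\mathbf{A}\in\mathbb{R}^{n\times n}$ be a nonzero positive semidefinite matrix. Let $(I,J)$ denote the pair returned by the rejection sampling algorithm described in the context on input $\mathbf{A}$. For all $i,j\in\{1,\dots,n\}$, $$\Pr[I=i,\,J=j]=\frac{\mathbf{A}_{ij}^2}{\|\mathbf{A}\|_{\mathrm F}^2}.$$ In turn, $\Pr[I=i]=\|\mathbf{A}_{*,i}\|_2^2/\|\mathbf{A}\|_{\mathrm F}^2$ and $\Pr[J=j]=\|\mathbf{A}_{*,j}\|_2^2/\|\mathbf{A}\|_{\mathrm F}^2$. The algorithm requires $2n$ entry queries and $O(n)$ arithmetic operations in expectation. Moreover, with probability $1-\delta$, the algorithm terminates using at most $n+\lceil n\log(1/\delta)\rceil$ entry accesses and $O(n\log(1/\delta))$ arithmetic operations.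
   Context: $\mathbf{A}_{*,i}$ is the $i$th column of $\mathbf{A}$, $\|\cdot\|_{\mathrm F}$ is the Frobenius norm, $\operatorname{tr}$ is the trace. A positive semidefinite matrix is a real symmetric matrix with $\mathbf{x}^\top\mathbf{A}\mathbf{x}\ge0$ for all $\mathbf{x}$. Here $\delta\in(0,1)$ is a failure probability. Algorithm. (1) Read the diagonal of $\mathbf{A}$ and define the distribution $\mathcal{D}(i)=\mathbf{A}_{ii}/\operatorname{tr}(\mathbf{A})$ for $i\in\{1,\dots,n\}$. (2) Repeat until a pair is returned: sample independent $I,J\sim\mathcal{D}$, and with probability $\mathbf{A}_{IJ}^2/(\mathbf{A}_{II}\mathbf{A}_{JJ})$ return $(I,J)$. Cost accounting: reading the diagonal takes $n$ entry queries; each round uses one additional entry query and a constant number of arithmetic operations.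
   Formalization: "2n entry queries in expectation" is an upper bound (the exact mean can be smaller), and the constant in O(n log(1/δ)) is uniform over n, A and δ ≤ δ₀ for each fixed δ₀ < 1, since no single constant works as δ tends to 1. *)

theory Defs
  imports "HOL-Probability.Probability" "Jordan_Normal_Form.Matrix"
begin

definition pos_semidef :: "real mat \<Rightarrow> bool" where
  "pos_semidef A \<longleftrightarrow> square_mat A \<and> transpose_mat A = A \<and>
     (\<forall>x \<in> carrier_vec (dim_row A). 0 \<le> scalar_prod x (A *\<^sub>v x))"

definition frobenius_norm :: "real mat \<Rightarrow> real" where
  "frobenius_norm A = sqrt (\<Sum>i<dim_row A. \<Sum>j<dim_col A. (A $$ (i, j))\<^sup>2)"

definition euclidean_norm :: "real vec \<Rightarrow> real" where
  "euclidean_norm v = sqrt (scalar_prod v v)"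

text \<open>
  Randomised computations with costs: a terminated run carries its result, the number of matrix
  entries it has read and the number of arithmetic operations it has performed. Divergence is the
  missing mass of the subprobability distribution.
\<close>

datatype 'a run = Run (result: 'a) (queries: nat) (arith_ops: nat)

type_synonym 'a comp = "'a run spmf"

definition ret :: "'a \<Rightarrow> 'a comp" where
  "ret x = return_spmf (Run x 0 0)"

definition bind_comp :: "'a comp \<Rightarrow> ('a \<Rightarrow> 'b comp) \<Rightarrow> 'b comp" (infixl \<open>\<triangleright>\<close> 54) where
  "m \<triangleright> f = bind_spmf m (\<lambda>r. map_spmf
     (\<lambda>s. Run (result s) (queries r + queries s) (arith_ops r + arith_ops s)) (f (result r)))"

definition query :: "real mat \<Rightarrow> nat \<Rightarrow> nat \<Rightarrow> real comp" where
  "query A i j = return_spmf (Run (A $$ (i, j)) 1 0)"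

definition arith :: "nat \<Rightarrow> 'a \<Rightarrow> 'a comp" where
  "arith c x = return_spmf (Run x 0 c)"

definition draw :: "nat \<Rightarrow> 'a pmf \<Rightarrow> 'a comp" where
  "draw c D = map_spmf (\<lambda>x. Run x 0 c) (spmf_of_pmf D)"

primrec map_comp :: "('a \<Rightarrow> 'b comp) \<Rightarrow> 'a list \<Rightarrow> 'b list comp" where
  "map_comp f [] = ret []"
| "map_comp f (x # xs) = f x \<triangleright> (\<lambda>y. map_comp f xs \<triangleright> (\<lambda>ys. ret (y # ys)))"

primrec sum_comp :: "real list \<Rightarrow> real comp" where
  "sum_comp [] = ret 0"
| "sum_comp (x # xs) = sum_comp xs \<triangleright> (\<lambda>s. arith 1 (x + s))"

lemma bind_comp_mono [partial_function_mono]: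
  assumes "mono_spmf B" and "\<And>y. mono_spmf (\<lambda>f. C y f)"
  shows "mono_spmf (\<lambda>f. B f \<triangleright> (\<lambda>y. C y f))"
  unfolding bind_comp_def by (intro bind_spmf_mono map_spmf_mono assms)

text \<open>
  The rejection loop. \<open>d\<close> is the stored diagonal of \<open>A\<close> (so that only \<open>A $$ (i, j)\<close> is queried in
  a round) and \<open>\<kappa>\<close> is the number of operations charged for one random draw, be it from
  \<open>D\<close> or the final coin toss.
\<close>

partial_function (spmf) rejection_loop ::
  "nat \<Rightarrow> real mat \<Rightarrow> real list \<Rightarrow> nat pmf \<Rightarrow> (nat \<times> nat) comp" where
  "rejection_loop \<kappa> A d D =
     draw \<kappa> D \<triangleright> (\<lambda>i. draw \<kappa> D \<triangleright> (\<lambda>j.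
     query A i j \<triangleright> (\<lambda>a.
     arith 1 (a * a) \<triangleright> (\<lambda>x. arith 1 (d ! i * d ! j) \<triangleright> (\<lambda>y. arith 1 (x / y) \<triangleright> (\<lambda>p.
     draw \<kappa> (bernoulli_pmf p) \<triangleright> (\<lambda>accept.
     if accept then ret (i, j) else rejection_loop \<kappa> A d D)))))))"

text \<open>
  The sampler on an \<open>n \<times> n\<close> matrix with rows and columns indexed by \<open>0..<n\<close>. Besides the explicit
  operations that compute the trace and the probabilities, \<open>\<kappa>\<^sub>0 * n\<close> operations are
  charged for building a data structure that supports draws at cost \<open>\<kappa>\<close> (e.g. an alias table).
\<close>

definition rejection_sampler :: "nat \<Rightarrow> nat \<Rightarrow> real mat \<Rightarrow> (nat \<times> nat) comp" where
  "rejection_sampler \<kappa>\<^sub>0 \<kappa> A =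
     map_comp (\<lambda>i. query A i i) [0..<dim_row A] \<triangleright> (\<lambda>d.
     sum_comp d \<triangleright> (\<lambda>t.
     map_comp (\<lambda>x. arith 1 (x / t)) d \<triangleright> (\<lambda>ps.
     arith (\<kappa>\<^sub>0 * dim_row A) (pmf_of_list (List.enumerate 0 ps)) \<triangleright> (\<lambda>D.
     rejection_loop \<kappa> A d D))))"

end

theory Submission
  imports Defs
begin

text \<open>
  A round returns \<open>(i, j)\<close> with probability \<open>(A $$ (i, j))\<^sup>2 / (tr A)\<^sup>2\<close>: where the diagonal vanishes
  so does the row, because the two-by-two principal minors are nonnegative. Hence a round succeeds
  with probability \<open>p\<close>, the squared Frobenius norm over \<open>(tr A)\<^sup>2\<close>, and Cauchy-Schwarz on the diagonal
  gives \<open>p \<ge> 1 / n\<close>. Rounds are independent, so the returned pair is independent of the number of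
  rounds, which is geometric with parameter \<open>p\<close>; its mean is \<open>1 / p \<le> n\<close>, and it exceeds \<open>m\<close> with
  probability \<open>(1 - p) ^ m \<le> exp (- m / n)\<close>.
\<close>

section \<open>Cost bookkeeping for randomised computations\<close>

definition charge :: "nat \<Rightarrow> nat \<Rightarrow> 'a comp \<Rightarrow> 'a comp" where
  "charge q a = map_spmf (\<lambda>s. Run (result s) (q + queries s) (a + arith_ops s))"

lemma charge_charge: "charge q a (charge q' a' m) = charge (q + q') (a + a') m"
  by (simp add: charge_def spmf.map_comp o_def add.assoc)

lemma charge_0: "charge 0 0 m = m"
  by (simp add: charge_def)

lemma charge_ret: "charge q a (ret x) = return_spmf (Run x q a)"
  by (simp add: charge_def ret_def)

lemma charge_bind_pmf: "charge q a (bind_pmf D f) = bind_pmf D (\<lambda>x. charge q a (f x))"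
  by (simp add: charge_def map_bind_pmf)

lemma charge_bind_comp: "charge q a m \<triangleright> f = charge q a (m \<triangleright> f)"
  by (simp add: charge_def bind_comp_def bind_map_spmf map_spmf_bind_spmf o_def spmf.map_comp add.assoc)

lemma ret_bind_comp: "ret x \<triangleright> f = f x"
  by (simp add: ret_def bind_comp_def)

lemma query_eq_charge: "query A i j = charge 1 0 (ret (A $$ (i, j)))"
  by (simp add: query_def charge_ret)

lemma arith_eq_charge: "arith c x = charge 0 c (ret x)"
  by (simp add: arith_def charge_ret)

lemma draw_bind_comp: "draw c D \<triangleright> f = bind_pmf D (\<lambda>x. charge 0 c (f x))"
  by (simp add: draw_def bind_comp_def charge_def bind_map_pmf)

text \<open>Rewriting with these pushes each \<open>charge\<close> inward past the random draws and
  merges adjacent ones, so a program becomes nested \<open>bind_pmf\<close> with its deterministic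
  cost collected at the leaves.\<close>

lemmas comp_normalise =
  query_eq_charge arith_eq_charge draw_bind_comp charge_bind_comp ret_bind_comp
  charge_bind_pmf charge_charge

lemma map_comp_charge:
  "map_comp (\<lambda>x. charge q a (ret (f x))) xs =
     charge (q * length xs) (a * length xs) (ret (map f xs))"
  by (induction xs) (simp_all add: comp_normalise charge_0)

lemma sum_comp_eq_charge: "sum_comp xs = charge 0 (length xs) (ret (sum_list xs))"
  by (induction xs) (simp_all add: comp_normalise charge_0)

section \<open>Restarting an experiment until it succeeds\<close>

text \<open>Since \<open>P\<close> has total mass one, the outcomes \<open>Some x\<close> together
  have mass \<open>p\<close>; the rest falls on \<open>None\<close>.\<close>

lemma pmf_None_proportional:
  fixes R :: "'a option pmf"
  assumes "0 \<le> p" and R: "\<And>x. pmf R (Some x) = p * pmf P x"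
  shows "pmf R None = 1 - p"
proof -
  have "ennreal (weight_spmf R) = (\<integral>\<^sup>+ x. ennreal p * ennreal (pmf P x) \<partial>count_space UNIV)"
    unfolding weight_spmf_eq_nn_integral_spmf by (simp add: R ennreal_mult' assms)
  also have "\<dots> = ennreal p"
    by (simp add: nn_integral_cmult nn_integral_pmf_eq_1)
  finally show ?thesis
    using assms by (simp add: pmf_None_eq_weight_spmf weight_spmf_nonneg)
qed

text \<open>
  The recursion equation determines the mass of a run with \<open>q\<close> queries by induction on \<open>q\<close>,
  so no appeal to the least fixed point is needed.
\<close>

lemma geometric_restart:
  fixes R :: "'a option pmf"
  assumes p: "0 < p" "p \<le> 1" and R: "\<And>x. pmf R (Some x) = p * pmf P x"
    and L: "L = bind_pmf R (\<lambda>r. charge 1 c (case r of None \<Rightarrow> L | Some x \<Rightarrow> ret x))"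
  shows "L = spmf_of_pmf (map_pmf (\<lambda>(k, x). Run x (Suc k) (c * Suc k))
               (pair_pmf (geometric_pmf p) P))"
    (is "L = spmf_of_pmf (map_pmf ?f ?G)")
proof (rule spmf_eqI)
  have None: "pmf R None = 1 - p"
    using p R by (intro pmf_None_proportional) auto
  have step: "spmf L (Run x q a) =
      (1 - p) * spmf (charge 1 c L) (Run x q a) + (if q = 1 \<and> a = c then p * pmf P x else 0)"
    for x q a
  proof -
    have "spmf L (Run x q a) = (\<integral>r. spmf (charge 1 c (case r of None \<Rightarrow> L | Some x \<Rightarrow> ret x)) (Run x q a) \<partial>R)"
      by (subst L) (simp add: pmf_bind)
    \<comment> \<open>Only two outcomes of the first round can lead to \<open>Run x q a\<close>: a
      rejection followed by a restart, or the acceptance of \<open>x\<close> itself.\<close>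
    also have "\<dots> = (\<integral>r. indicator {None} r * spmf (charge 1 c L) (Run x q a)
                       + indicator {Some x} r * (if q = 1 \<and> a = c then 1 else 0) \<partial>R)"
      by (intro Bochner_Integration.integral_cong)
        (auto simp: charge_ret indicator_def split: option.split)
    also have "\<dots> = (1 - p) * spmf (charge 1 c L) (Run x q a)
                       + (if q = 1 \<and> a = c then p * pmf P x else 0)"
      by (subst Bochner_Integration.integral_add)
        (auto simp: measure_pmf_single None R
          intro!: measure_pmf.integrable_const_bound[where B = 1])
    finally show ?thesis .
  qed
  have charge: "spmf (charge 1 c L) (Run x q a) =
      (if q = 0 \<or> a < c then 0 else spmf L (Run x (q - 1) (a - c)))" for x q a
  proof -
    let ?g = "\<lambda>s::'a run. Run (result s) (1 + queries s) (c + arith_ops s)"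
    \<comment> \<open>The cost shift is injective, so the mass at a point is that of its unique
      preimage; no preimage exists if \<open>q = 0\<close> or \<open>a < c\<close>, where natural
      subtraction would truncate.\<close>
    have "inj ?g"
      by (auto simp: inj_on_def intro: run.expand)
    show ?thesis
    proof (cases "q = 0 \<or> a < c")
      case True
      then show ?thesis
        unfolding charge_def by (subst spmf_map_outside) auto
    next
      case False
      then have "Run x q a = ?g (Run x (q - 1) (a - c))"
        by simp
      then show ?thesis
        unfolding charge_def using spmf_map_inj'[OF \<open>inj ?g\<close>] False by metis
    qed
  qed
  have rec: "spmf L (Run x q a) =
      (if q = 0 \<or> a < c then 0 else (1 - p) * spmf L (Run x (q - 1) (a - c)))
      + (if q = 1 \<and> a = c then p * pmf P x else 0)" for x q a
    unfolding step[of x q a] charge by simp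
  have L_eq: "spmf L (Run x q a) =
      (if q > 0 \<and> a = c * q then (1 - p) ^ (q - 1) * p * pmf P x else 0)" for x q a
  proof (induction q arbitrary: a)
    case 0
    then show ?case by (simp add: rec[of x 0])
  next
    case (Suc q)
    \<comment> \<open>If the predecessor is 0, only immediate acceptance contributes; otherwise only
      the restart does, adding one factor \<open>1 - p\<close>.\<close>
    show ?case
      unfolding rec[of x "Suc q" a] diff_Suc_1 Suc.IH by (cases q) auto
  qed
  fix s :: "'a run"
  obtain x q a where s: "s = Run x q a"
    by (cases s)
  have "pmf (map_pmf ?f ?G) s = (if q > 0 \<and> a = c * q then (1 - p) ^ (q - 1) * p * pmf P x else 0)"
  proof (cases "q > 0 \<and> a = c * q")
    case True
    \<comment> \<open>\<open>geometric_pmf\<close> counts the failures before the first success, so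
      \<open>k\<close> failures mean \<open>Suc k\<close> rounds, each with one query and
      \<open>c\<close> operations.\<close>
    then obtain k where q: "q = Suc k" and a: "a = c * Suc k"
      by (cases q) auto
    have "?f -` {s} = {(k, x)}"
      by (auto simp: s q a simp del: mult_Suc_right)
    then show ?thesis
      using p by (simp add: pmf_map measure_pmf_single pmf_pair q a)
  next
    case False
    then have "?f y \<noteq> s" for y
      by (cases y) (auto simp: s simp del: mult_Suc_right)
    then have "?f -` {s} = {}"
      by blast
    then show ?thesis
      using False by (simp only: pmf_map measure_empty if_False)
  qed
  then show "spmf L s = spmf (spmf_of_pmf (map_pmf ?f ?G)) s"
    by (simp add: s L_eq)
qed

section \<open>Mean and tail of the geometric distribution\<close>

text \<open>The mean number of failures is \<open>(1 - p) / p\<close>, hence that of rounds is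
  \<open>1 / p\<close>. The affine form covers a setup cost \<open>a\<close> plus a cost
  \<open>b\<close> per round.\<close>

lemma nn_integral_geometric_affine:
  assumes p: "0 < p" "p \<le> 1" and "0 \<le> a" "0 \<le> b"
  shows "(\<integral>\<^sup>+ k. ennreal (a + b * real (Suc k)) \<partial>geometric_pmf p) = ennreal (a + b / p)"
proof -
  have int: "integrable (geometric_pmf p) real"
    using p by (intro integrable_real_geometric_pmf) auto
  have "(\<integral>\<^sup>+ k. ennreal (a + b * real (Suc k)) \<partial>geometric_pmf p) =
      ennreal (\<integral>k. (a + b) + b * real k \<partial>geometric_pmf p)"
    using assms int
    by (subst nn_integral_eq_integral[symmetric]) (auto simp: algebra_simps)
  also have "(\<integral>k. (a + b) + b * real k \<partial>geometric_pmf p) = a + b + b * ((1 - p) / p)"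
    using int p by (simp add: expectation_geometric_pmf)
  also have "\<dots> = a + b / p"
    using p by (simp add: field_simps)
  finally show ?thesis .
qed

text \<open>The complementary event is that the first \<open>m\<close> rounds all fail.\<close>

lemma measure_geometric_lessThan:
  assumes p: "0 < p" "p \<le> 1"
  shows "measure (geometric_pmf p) {..<m} = 1 - (1 - p) ^ m"
proof -
  have "(\<Sum>k<m. (1 - p) ^ k * p) = 1 - (1 - p) ^ m"
    by (induction m) (simp_all add: algebra_simps)
  then show ?thesis
    using p by (simp add: measure_measure_pmf_finite)
qed

section \<open>Entries, trace and Frobenius norm of a positive semidefinite matrix\<close>

lemma scalar_prod_unit_vec_mult:
  fixes A :: "real mat"
  assumes "A \<in> carrier_mat n n" "i < n" "j < n"
  shows "scalar_prod (unit_vec n i) (A *\<^sub>v unit_vec n j) = A $$ (i, j)"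
  using assms by (simp add: mult_mat_vec_def)

locale nonzero_psd =
  fixes A :: "real mat" and n :: nat
  assumes A: "A \<in> carrier_mat n n" and psd: "pos_semidef A" and nonzero: "A \<noteq> 0\<^sub>m n n"
begin

definition tr :: real where "tr = (\<Sum>i<n. A $$ (i, i))"

definition sqsum :: real where "sqsum = (\<Sum>i<n. \<Sum>j<n. (A $$ (i, j))\<^sup>2)"

text \<open>By \<open>pmf_round_pmf\<close> this is the probability that one round accepts.\<close>

definition accept_prob :: real where "accept_prob = sqsum / tr\<^sup>2"

lemma symmetric: "i < n \<Longrightarrow> j < n \<Longrightarrow> A $$ (i, j) = A $$ (j, i)"
  using psd A unfolding pos_semidef_def by (metis carrier_matD index_transpose_mat(1))

text \<open>The quadratic form is evaluated at \<open>s\<close> times the \<open>i\<close>th plus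
  \<open>t\<close> times the \<open>j\<close>th unit vector. Free coefficients let one lemma yield
  both the sign of the diagonal and the two-by-two minors.\<close>

lemma quadratic_form_nonneg:
  assumes "i < n" "j < n"
  shows "0 \<le> s\<^sup>2 * A $$ (i, i) + 2 * s * t * A $$ (i, j) + t\<^sup>2 * A $$ (j, j)"
proof -
  let ?x = "s \<cdot>\<^sub>v unit_vec n i + t \<cdot>\<^sub>v unit_vec n j"
  have "0 \<le> scalar_prod ?x (A *\<^sub>v ?x)"
    using psd A unfolding pos_semidef_def by auto
  also have "A *\<^sub>v ?x = s \<cdot>\<^sub>v (A *\<^sub>v unit_vec n i) + t \<cdot>\<^sub>v (A *\<^sub>v unit_vec n j)"
    using A by (simp add: mult_add_distrib_mat_vec[of _ n n] mult_mat_vec[of _ n n])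
  also have "scalar_prod ?x \<dots> =
      s\<^sup>2 * A $$ (i, i) + s * t * A $$ (i, j) + (s * t * A $$ (j, i) + t\<^sup>2 * A $$ (j, j))"
    using A assms
    by (simp add: add_scalar_prod_distrib[of _ n] scalar_prod_add_distrib[of _ n]
        scalar_prod_unit_vec_mult[OF A] algebra_simps power2_eq_square
        del: scalar_prod_left_unit scalar_prod_right_unit)
  finally show ?thesis
    using symmetric[OF assms] by (simp add: algebra_simps)
qed

lemma diag_nonneg: "i < n \<Longrightarrow> 0 \<le> A $$ (i, i)"
  using quadratic_form_nonneg[of i i 1 0] by simp

lemma entry_sq_le:
  assumes "i < n" "j < n"
  shows "(A $$ (i, j))\<^sup>2 \<le> A $$ (i, i) * A $$ (j, j)"
proof (cases "A $$ (i, i) = 0")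
  case True
  have "A $$ (i, j) = 0"
  proof (rule ccontr)
    assume "A $$ (i, j) \<noteq> 0"
    \<comment> \<open>With \<open>A $$ (i, i) = 0\<close> and \<open>t = 1\<close> the form is
      affine in \<open>s\<close> with nonzero slope; this \<open>s\<close> gives it the value
      -1.\<close>
    then show False
      using quadratic_form_nonneg[OF assms, of "- (A $$ (j, j) + 1) / (2 * A $$ (i, j))" 1] True
      by (simp add: field_simps)
  qed
  then show ?thesis using True by simp
next
  case False
  then have pos: "0 < A $$ (i, i)"
    using diag_nonneg[OF assms(1)] by simp
  \<comment> \<open>These coefficients make the form equal to the principal minor times
    \<open>A $$ (i, i)\<close>, which is then cancelled.\<close>
  have "0 \<le> A $$ (i, i) * (A $$ (i, i) * A $$ (j, j) - (A $$ (i, j))\<^sup>2)"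
    using quadratic_form_nonneg[OF assms, of "- A $$ (i, j)" "A $$ (i, i)"]
    by (simp add: algebra_simps power2_eq_square)
  then show ?thesis
    using pos by (simp add: zero_le_mult_iff)
qed

lemma n_pos: "0 < n"
  using nonzero A by (cases "n = 0") auto

text \<open>A zero trace would force a zero diagonal, and \<open>entry_sq_le\<close> would then make
  every entry zero.\<close>

lemma tr_pos: "0 < tr"
proof (rule ccontr)
  assume "\<not> 0 < tr"
  then have "tr = 0"
    unfolding tr_def using sum_nonneg[of "{..<n}" "\<lambda>i. A $$ (i, i)"] diag_nonneg by fastforce
  then have "A $$ (i, i) = 0" if "i < n" for i
    using that diag_nonneg sum_nonneg_eq_0_iff[of "{..<n}" "\<lambda>i. A $$ (i, i)"]
    unfolding tr_def by auto
  then have "A = 0\<^sub>m n n"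
    using A entry_sq_le by (intro eq_matI) auto
  then show False using nonzero by simp
qed

text \<open>Cauchy-Schwarz on the diagonal, followed by adding the off-diagonal squares. Cleared of
  denominators, this is the bound \<open>1 / n\<close> from below on
  \<open>accept_prob\<close>.\<close>

lemma tr_sq_le: "tr\<^sup>2 \<le> real n * sqsum"
proof -
  have "tr\<^sup>2 \<le> real n * (\<Sum>i<n. (A $$ (i, i))\<^sup>2)"
    unfolding tr_def using sum_squared_le_sum_of_squares[of "\<lambda>i. A $$ (i, i)" "{..<n}"]
    by (simp add: mult.commute)
  also have "\<dots> \<le> real n * sqsum"
    unfolding sqsum_def
    by (intro mult_left_mono sum_mono member_le_sum[of _ _ "\<lambda>j. (A $$ (_, j))\<^sup>2"]) auto
  finally show ?thesis .
qed

lemma sqsum_pos: "0 < sqsum"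
  using tr_sq_le tr_pos n_pos by (smt (verit) mult_le_0_iff of_nat_0_less_iff zero_less_power)

lemma accept_prob_pos: "0 < accept_prob"
  unfolding accept_prob_def using sqsum_pos tr_pos by simp

text \<open>Summing \<open>entry_sq_le\<close> over all pairs gives a double sum that factors into
  the squared trace.\<close>

lemma accept_prob_le_1: "accept_prob \<le> 1"
proof -
  have "sqsum \<le> (\<Sum>i<n. \<Sum>j<n. A $$ (i, i) * A $$ (j, j))"
    unfolding sqsum_def by (intro sum_mono entry_sq_le) auto
  also have "\<dots> = tr\<^sup>2"
    by (simp add: tr_def power2_eq_square sum_product)
  finally show ?thesis
    using tr_pos by (simp add: accept_prob_def)
qed

lemma inverse_accept_prob_le: "1 / accept_prob \<le> real n"
  using tr_sq_le sqsum_pos tr_pos by (simp add: accept_prob_def field_simps)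

lemma frobenius_norm_sq: "(frobenius_norm A)\<^sup>2 = sqsum"
  using A by (simp add: frobenius_norm_def sqsum_def sum_nonneg)

lemma euclidean_norm_col_sq:
  assumes "i < n"
  shows "(euclidean_norm (col A i))\<^sup>2 = (\<Sum>k<n. (A $$ (k, i))\<^sup>2)"
proof -
  have "scalar_prod (col A i) (col A i) = (\<Sum>k<n. (A $$ (k, i))\<^sup>2)"
    using A assms by (simp add: scalar_prod_def power2_eq_square lessThan_atLeast0)
  then show ?thesis
    by (simp add: euclidean_norm_def sum_nonneg)
qed

section \<open>The target distribution on index pairs and its marginals\<close>

definition sq_pmf :: "(nat \<times> nat) pmf" where
  "sq_pmf = embed_pmf (\<lambda>(i, j). if i < n \<and> j < n then (A $$ (i, j))\<^sup>2 / sqsum else 0)"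

lemma pmf_sq_pmf: "pmf sq_pmf (i, j) = (if i < n \<and> j < n then (A $$ (i, j))\<^sup>2 / sqsum else 0)"
proof -
  let ?f = "\<lambda>(i, j). if i < n \<and> j < n then (A $$ (i, j))\<^sup>2 / sqsum else 0"
  have "(\<integral>\<^sup>+ x. ennreal (?f x) \<partial>count_space UNIV) = (\<Sum>x\<in>{..<n} \<times> {..<n}. ennreal (?f x))"
    by (rule nn_integral_count_space') (auto split: if_splits)
  also have "\<dots> = ennreal (\<Sum>x\<in>{..<n} \<times> {..<n}. ?f x)"
    using sqsum_pos by (intro sum_ennreal) auto
  also have "(\<Sum>x\<in>{..<n} \<times> {..<n}. ?f x) = (\<Sum>i<n. \<Sum>j<n. (A $$ (i, j))\<^sup>2 / sqsum)"
    by (subst sum.cartesian_product) (auto intro!: sum.cong)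
  also have "\<dots> = 1"
    using sqsum_pos by (simp add: sqsum_def flip: sum_divide_distrib)
  finally show ?thesis
    unfolding sq_pmf_def using sqsum_pos by (subst pmf_embed_pmf) (auto split: prod.split)
qed

text \<open>Fixing the first component gives a sum over row \<open>i\<close>; symmetry turns it into
  the column sum. The second marginal is a column sum directly.\<close>

lemma pmf_map_fst_sq_pmf:
  assumes "i < n"
  shows "pmf (map_pmf fst sq_pmf) i = (\<Sum>k<n. (A $$ (k, i))\<^sup>2) / sqsum"
proof -
  \<comment> \<open>The preimage of \<open>i\<close> under \<open>fst\<close> is infinite; pairs off
    the grid have mass zero, so a finite row suffices.\<close>
  have "pmf (map_pmf fst sq_pmf) i = measure sq_pmf (Pair i ` {..<n})"
    unfolding pmf_map using assms pmf_sq_pmf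
    by (intro measure_prob_cong_0) (auto split: if_splits)
  also have "\<dots> = (\<Sum>k<n. (A $$ (k, i))\<^sup>2) / sqsum"
    using assms
    by (simp add: measure_measure_pmf_finite sum.reindex inj_on_def pmf_sq_pmf sum_divide_distrib
        symmetric[OF assms])
  finally show ?thesis .
qed

lemma pmf_map_snd_sq_pmf:
  assumes "j < n"
  shows "pmf (map_pmf snd sq_pmf) j = (\<Sum>k<n. (A $$ (k, j))\<^sup>2) / sqsum"
proof -
  have "pmf (map_pmf snd sq_pmf) j = measure sq_pmf ((\<lambda>k. (k, j)) ` {..<n})"
    unfolding pmf_map using assms pmf_sq_pmf
    by (intro measure_prob_cong_0) (auto split: if_splits)
  also have "\<dots> = (\<Sum>k<n. (A $$ (k, j))\<^sup>2) / sqsum"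
    using assms
    by (simp add: measure_measure_pmf_finite sum.reindex inj_on_def pmf_sq_pmf sum_divide_distrib)
  finally show ?thesis .
qed

section \<open>The distribution of a single round\<close>

text \<open>Kept in the list form that the sampler builds, so that unfolding
  \<open>rejection_sampler\<close> produces exactly this distribution.\<close>

definition diag_pmf :: "nat pmf" where
  "diag_pmf = pmf_of_list (List.enumerate 0 (map (\<lambda>i. A $$ (i, i) / tr) [0..<n]))"

lemma pmf_diag_pmf: "pmf diag_pmf i = (if i < n then A $$ (i, i) / tr else 0)"
proof -
  let ?xs = "map (\<lambda>i. (i, A $$ (i, i) / tr)) [0..<n]"
  have xs: "List.enumerate 0 (map (\<lambda>i. A $$ (i, i) / tr) [0..<n]) = ?xs"
    by (rule nth_equalityI) (auto simp: nth_enumerate_eq)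
  have "sum_list (map snd ?xs) = (\<Sum>i<n. A $$ (i, i) / tr)"
    by (simp add: o_def interv_sum_list_conv_sum_set_nat lessThan_atLeast0)
  also have "\<dots> = 1"
    using tr_pos by (simp add: tr_def flip: sum_divide_distrib)
  finally have "pmf_of_list_wf ?xs"
    using tr_pos diag_nonneg by (intro pmf_of_list_wfI) auto
  then have "pmf diag_pmf i = sum_list (map snd (filter (\<lambda>z. fst z = i) ?xs))"
    unfolding diag_pmf_def xs by (rule pmf_pmf_of_list)
  also have "filter (\<lambda>z. fst z = i) ?xs = (if i < n then [(i, A $$ (i, i) / tr)] else [])"
    by (induction n) (auto simp: filter_map o_def)
  finally show ?thesis by simp
qed

text \<open>\<open>None\<close> marks a rejection. Costs are left out, because every round costs the
  same whatever its outcome.\<close>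

definition round_pmf :: "(nat \<times> nat) option pmf" where
  "round_pmf = bind_pmf diag_pmf (\<lambda>i. bind_pmf diag_pmf (\<lambda>j.
     bind_pmf (bernoulli_pmf ((A $$ (i, j) * A $$ (i, j)) / (A $$ (i, i) * A $$ (j, j))))
       (\<lambda>b. return_pmf (if b then Some (i, j) else None))))"

text \<open>The diagonal entries in the proposal probability cancel against the denominator of the
  acceptance probability, leaving the squared entry over the squared trace.\<close>

lemma pmf_round_pmf: "pmf round_pmf (Some x) = accept_prob * pmf sq_pmf x"
proof -
  obtain i j where x: "x = (i, j)" by (cases x)
  let ?q = "\<lambda>(i, j). (A $$ (i, j) * A $$ (i, j)) / (A $$ (i, i) * A $$ (j, j))"
  let ?G = "pair_pmf diag_pmf diag_pmf"
  have "round_pmf = bind_pmf ?G (\<lambda>y. map_pmf (\<lambda>b. if b then Some y else None) (bernoulli_pmf (?q y)))"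
    by (simp add: round_pmf_def pair_pmf_def bind_assoc_pmf bind_return_pmf map_pmf_def)
  then have "pmf round_pmf (Some x) =
      (\<integral>y. pmf (map_pmf (\<lambda>b. if b then Some y else None) (bernoulli_pmf (?q y))) (Some x) \<partial>?G)"
    by (simp add: pmf_bind)
  also have "\<dots> = (\<integral>y. indicator {x} y * pmf (bernoulli_pmf (?q x)) True \<partial>?G)"
  proof (rule Bochner_Integration.integral_cong)
    fix y
    have "(\<lambda>b. if b then Some y else None) -` {Some x} = (if y = x then {True} else {})"
      by (auto split: if_splits)
    then show "pmf (map_pmf (\<lambda>b. if b then Some y else None) (bernoulli_pmf (?q y))) (Some x) =
        indicator {x} y * pmf (bernoulli_pmf (?q x)) True"
      by (simp add: pmf_map measure_pmf_single)
  qed simp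
  also have "\<dots> = pmf ?G x * pmf (bernoulli_pmf (?q x)) True"
    by (simp add: measure_pmf_single)
  also have "\<dots> = accept_prob * pmf sq_pmf x"
  proof (cases "i < n \<and> j < n")
    case True
    \<comment> \<open>The Bernoulli parameter must lie in the unit interval for \<open>True\<close>
      to have that mass; a zero denominator gives the value 0.\<close>
    then have "0 \<le> ?q x" "?q x \<le> 1"
      using entry_sq_le[of i j] diag_nonneg[of i] diag_nonneg[of j]
      by (auto simp: x divide_le_eq_1 power2_eq_square mult_less_0_iff zero_less_mult_iff)
    then have "pmf ?G x * pmf (bernoulli_pmf (?q x)) True =
        (A $$ (i, i) * A $$ (j, j) * ?q x) / tr\<^sup>2"
      using True by (simp add: x pmf_pair pmf_diag_pmf power2_eq_square)
    \<comment> \<open>Cancellation survives a zero denominator, since \<open>entry_sq_le\<close>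
      then makes the entry zero too.\<close>
    also have "A $$ (i, i) * A $$ (j, j) * ?q x = (A $$ (i, j))\<^sup>2"
      using entry_sq_le[of i j] True by (auto simp: x power2_eq_square mult_le_0_iff)
    also have "\<dots> / tr\<^sup>2 = accept_prob * pmf sq_pmf x"
      using True sqsum_pos by (simp add: x pmf_sq_pmf accept_prob_def)
    finally show ?thesis .
  next
    case False
    then have "pmf ?G x = 0" "pmf sq_pmf x = 0"
      by (auto simp: x pmf_pair pmf_diag_pmf pmf_sq_pmf)
    then show ?thesis
      by (simp only: mult_zero_left mult_zero_right)
  qed
  finally show ?thesis .
qed

section \<open>The joint law of result and cost\<close>

text \<open>A round makes three draws at cost \<kappa> each (two indices and the coin) and three
  arithmetic operations, hence \<open>3 * \<kappa> + 3\<close>.\<close>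

lemma rejection_loop_eq:
  "rejection_loop \<kappa> A (map (\<lambda>i. A $$ (i, i)) [0..<n]) diag_pmf =
     spmf_of_pmf (map_pmf (\<lambda>(k, x). Run x (Suc k) ((3 * \<kappa> + 3) * Suc k))
       (pair_pmf (geometric_pmf accept_prob) sq_pmf))"
proof (rule geometric_restart[OF accept_prob_pos accept_prob_le_1 pmf_round_pmf])
  let ?L = "rejection_loop \<kappa> A (map (\<lambda>i. A $$ (i, i)) [0..<n]) diag_pmf"
  let ?d = "map (\<lambda>i. A $$ (i, i)) [0..<n]"
  \<comment> \<open>Looking up the stored diagonal yields a matrix entry only for indices below
    \<open>n\<close>; drawn indices satisfy this.\<close>
  have supp: "i < n" if "i \<in> set_pmf diag_pmf" for i
    using that by (auto simp: set_pmf_iff pmf_diag_pmf split: if_splits)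
  have "?L = bind_pmf diag_pmf (\<lambda>i. bind_pmf diag_pmf (\<lambda>j.
      bind_pmf (bernoulli_pmf ((A $$ (i, j) * A $$ (i, j)) / (?d ! i * ?d ! j)))
       (\<lambda>b. charge 1 (3 * \<kappa> + 3) (if b then ret (i, j) else ?L))))"
    by (subst rejection_loop.simps) (simp add: comp_normalise numeral_3_eq_3)
  also have "\<dots> = bind_pmf diag_pmf (\<lambda>i. bind_pmf diag_pmf (\<lambda>j.
      bind_pmf (bernoulli_pmf ((A $$ (i, j) * A $$ (i, j)) / (A $$ (i, i) * A $$ (j, j))))
       (\<lambda>b. charge 1 (3 * \<kappa> + 3) (if b then ret (i, j) else ?L))))"
    by (intro bind_pmf_cong refl) (simp add: supp)
  also have "\<dots> = bind_pmf round_pmf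
      (\<lambda>r. charge 1 (3 * \<kappa> + 3) (case r of None \<Rightarrow> ?L | Some x \<Rightarrow> ret x))"
    unfolding round_pmf_def bind_assoc_pmf bind_return_pmf
    by (intro bind_pmf_cong refl) simp
  finally show "?L = bind_pmf round_pmf
      (\<lambda>r. charge 1 (3 * \<kappa> + 3) (case r of None \<Rightarrow> ?L | Some x \<Rightarrow> ret x))" .
qed

text \<open>The setup reads \<open>n\<close> diagonal entries and performs \<open>n\<close>
  additions (the sum starts from 0), \<open>n\<close> divisions and
  \<open>\<kappa>\<^sub>0 * n\<close> operations for the sampling structure.\<close>

lemma rejection_sampler_eq:
  "rejection_sampler \<kappa>\<^sub>0 \<kappa> A =
     spmf_of_pmf (map_pmf (\<lambda>(k, x). Run x (n + Suc k) ((2 + \<kappa>\<^sub>0) * n + (3 * \<kappa> + 3) * Suc k))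
       (pair_pmf (geometric_pmf accept_prob) sq_pmf))"
proof -
  have tr: "sum_list (map (\<lambda>i. A $$ (i, i)) [0..<n]) = tr"
    by (simp add: tr_def interv_sum_list_conv_sum_set_nat lessThan_atLeast0)
  have "rejection_sampler \<kappa>\<^sub>0 \<kappa> A = charge n ((2 + \<kappa>\<^sub>0) * n)
      (rejection_loop \<kappa> A (map (\<lambda>i. A $$ (i, i)) [0..<n]) diag_pmf)"
    using A
    by (simp add: rejection_sampler_def comp_normalise map_comp_charge sum_comp_eq_charge tr
        diag_pmf_def o_def algebra_simps)
  then show ?thesis
    by (simp add: rejection_loop_eq charge_def map_pmf_comp case_prod_unfold)
qed

lemma lossless_rejection_sampler: "lossless_spmf (rejection_sampler \<kappa>\<^sub>0 \<kappa> A)"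
  by (simp add: rejection_sampler_eq)

text \<open>The result is one component of a product distribution, so the number of rounds drops
  out. A general \<open>f\<close> covers the pair and both marginals.\<close>

lemma map_result_rejection_sampler:
  "map_spmf (\<lambda>r. f (result r)) (rejection_sampler \<kappa>\<^sub>0 \<kappa> A) = spmf_of_pmf (map_pmf f sq_pmf)"
proof -
  have "map_pmf f sq_pmf = map_pmf f (map_pmf snd (pair_pmf (geometric_pmf accept_prob) sq_pmf))"
    by (simp add: map_snd_pair_pmf)
  then show ?thesis
    by (simp add: rejection_sampler_eq map_pmf_comp case_prod_unfold)
qed

section \<open>Cost bounds in expectation and with high probability\<close>

lemma expected_queries_le:
  "(\<integral>\<^sup>+ r. ennreal (real (queries r)) \<partial>measure_spmf (rejection_sampler \<kappa>\<^sub>0 \<kappa> A)) \<le> ennreal (2 * real n)"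
proof -
  have "(\<integral>\<^sup>+ r. ennreal (real (queries r)) \<partial>measure_spmf (rejection_sampler \<kappa>\<^sub>0 \<kappa> A)) =
      (\<integral>\<^sup>+ k. ennreal (real n + 1 * real (Suc k)) \<partial>geometric_pmf accept_prob)"
    by (simp add: rejection_sampler_eq case_prod_unfold nn_integral_pair_pmf' add_ac)
  also have "\<dots> = ennreal (real n + 1 / accept_prob)"
    using accept_prob_pos accept_prob_le_1 by (intro nn_integral_geometric_affine) auto
  also have "\<dots> \<le> ennreal (2 * real n)"
    using inverse_accept_prob_le by (intro ennreal_leI) simp
  finally show ?thesis .
qed

lemma expected_arith_ops_le:
  "(\<integral>\<^sup>+ r. ennreal (real (arith_ops r)) \<partial>measure_spmf (rejection_sampler \<kappa>\<^sub>0 \<kappa> A))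
     \<le> ennreal (real (5 + \<kappa>\<^sub>0 + 3 * \<kappa>) * real n)"
proof -
  have "(\<integral>\<^sup>+ r. ennreal (real (arith_ops r)) \<partial>measure_spmf (rejection_sampler \<kappa>\<^sub>0 \<kappa> A)) =
      (\<integral>\<^sup>+ k. ennreal (real (2 + \<kappa>\<^sub>0) * real n + real (3 * \<kappa> + 3) * real (Suc k)) \<partial>geometric_pmf accept_prob)"
    unfolding rejection_sampler_eq
    by (simp only: measure_spmf_spmf_of_pmf nn_integral_map_pmf nn_integral_pair_pmf' case_prod_conv
        run.sel of_nat_add of_nat_mult nn_integral_const measure_pmf.emeasure_space_1
        mult_1_right)
  also have "\<dots> = ennreal (real (2 + \<kappa>\<^sub>0) * real n + real (3 * \<kappa> + 3) / accept_prob)"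
    using accept_prob_pos accept_prob_le_1 by (intro nn_integral_geometric_affine) auto
  \<comment> \<open>The constant is the sum of the setup coefficient
    \<open>2 + \<kappa>\<^sub>0\<close> and the round cost \<open>3 * \<kappa> + 3\<close>, as at
    most \<open>n\<close> rounds are expected.\<close>
  also have "\<dots> \<le> ennreal (real (5 + \<kappa>\<^sub>0 + 3 * \<kappa>) * real n)"
    using mult_left_mono[OF inverse_accept_prob_le, of "real (3 * \<kappa> + 3)"]
    by (intro ennreal_leI) (simp add: algebra_simps add_divide_distrib)
  finally show ?thesis .
qed

text \<open>The event \<open>S\<close> need only contain the runs of at most \<open>m\<close>
  rounds, so one tail estimate serves a joint bound on queries and operations.\<close>

lemma prob_cost_ge:
  assumes "0 < \<delta>"
    and m: "real n * ln (1 / \<delta>) \<le> real m"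
    and S: "\<And>k x. k < m \<Longrightarrow> Run x (n + Suc k) ((2 + \<kappa>\<^sub>0) * n + (3 * \<kappa> + 3) * Suc k) \<in> S"
  shows "1 - \<delta> \<le> measure (measure_spmf (rejection_sampler \<kappa>\<^sub>0 \<kappa> A)) S"
proof -
  have "(1 - accept_prob) ^ m \<le> exp (- accept_prob) ^ m"
    using exp_ge_add_one_self[of "- accept_prob"] accept_prob_le_1 by (intro power_mono) auto
  also have "\<dots> = exp (- (accept_prob * real m))"
    by (simp add: exp_of_nat_mult mult.commute flip: exp_of_nat_mult)
  also have "\<dots> \<le> exp (- ln (1 / \<delta>))"
  \<comment> \<open>Multiplying \<open>inverse_accept_prob_le\<close> by the logarithm needs its
    sign; for a negative logarithm the right side exceeds 1.\<close>
  proof (cases "0 \<le> ln (1 / \<delta>)")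
    case True
    have "ln (1 / \<delta>) = accept_prob * (1 / accept_prob * ln (1 / \<delta>))"
      using accept_prob_pos by simp
    also have "\<dots> \<le> accept_prob * (real n * ln (1 / \<delta>))"
      using True accept_prob_pos inverse_accept_prob_le by (intro mult_left_mono mult_right_mono) auto
    also have "\<dots> \<le> accept_prob * real m"
      using accept_prob_pos m by (intro mult_left_mono) auto
    finally show ?thesis by simp
  next
    case False
    moreover have "0 \<le> accept_prob * real m"
      using accept_prob_pos by simp
    ultimately show ?thesis by (smt (verit) exp_le_cancel_iff)
  qed
  also have "\<dots> = \<delta>"
    using \<open>0 < \<delta>\<close> by (simp add: ln_div)
  finally have "1 - \<delta> \<le> measure (geometric_pmf accept_prob) {..<m}"
    using accept_prob_pos accept_prob_le_1 by (simp add: measure_geometric_lessThan)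
  also have "\<dots> = measure (map_pmf fst (pair_pmf (geometric_pmf accept_prob) sq_pmf)) {..<m}"
    by (simp only: map_fst_pair_pmf)
  also have "\<dots> \<le> measure (measure_spmf (rejection_sampler \<kappa>\<^sub>0 \<kappa> A)) S"
    unfolding rejection_sampler_eq measure_spmf_spmf_of_pmf measure_map_pmf
    using S by (intro measure_pmf.finite_measure_mono) auto
  finally show ?thesis .
qed

text \<open>The setup cost is linear in \<open>n\<close> whatever \<delta> is, whereas the logarithm
  vanishes as \<delta> tends to 1. Keeping \<delta> below \<open>\<delta>\<^sub>0\<close> bounds the
  logarithm from below, so that setup and rounding are absorbed into \<open>C\<close>.\<close>

lemma prob_within_budget:
  fixes \<kappa>\<^sub>0 \<kappa> :: nat
  assumes "0 < \<delta>" "\<delta> \<le> \<delta>\<^sub>0" "\<delta>\<^sub>0 < 1"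
  defines "C \<equiv> (2 + \<kappa>\<^sub>0) / ln (1 / \<delta>\<^sub>0) + (3 * \<kappa> + 3) * (1 + 1 / ln (1 / \<delta>\<^sub>0))"
  shows "1 - \<delta> \<le> measure (measure_spmf (rejection_sampler \<kappa>\<^sub>0 \<kappa> A))
      {r. real (queries r) \<le> real n + of_int \<lceil>real n * ln (1 / \<delta>)\<rceil> \<and>
          real (arith_ops r) \<le> C * (real n * ln (1 / \<delta>))}"
    (is "_ \<le> measure _ ?S")
proof -
  define l0 where "l0 = ln (1 / \<delta>\<^sub>0)"
  define l where "l = real n * ln (1 / \<delta>)"
  define m where "m = nat \<lceil>l\<rceil>"
  have l0: "0 < l0"
    using assms by (simp add: l0_def)
  have "l0 \<le> ln (1 / \<delta>)"
    using assms by (simp add: l0_def ln_div)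
  then have l: "real n * l0 \<le> l"
    unfolding l_def by (intro mult_left_mono) auto
  then have n: "real n \<le> l / l0"
    using l0 by (simp add: pos_le_divide_eq)
  \<comment> \<open>Nonnegativity of \<open>l\<close> ensures that \<open>nat\<close> does not
    truncate the ceiling.\<close>
  have "0 \<le> real n * l0"
    using l0 by simp
  then have "0 \<le> l"
    using l by linarith
  then have m_int: "of_int \<lceil>l\<rceil> = real m"
    by (simp add: m_def)
  have "real m \<le> l + 1"
    using m_int by linarith
  \<comment> \<open>The 1 lost by rounding up is at most \<open>n\<close>, which is at most
    \<open>l / l0\<close>.\<close>
  also have "\<dots> \<le> l * (1 + 1 / l0)"
    using n n_pos by (simp add: algebra_simps)
  finally have m_le: "real m \<le> l * (1 + 1 / l0)" .
  show ?thesis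
  proof (rule prob_cost_ge[OF \<open>0 < \<delta>\<close>])
    show "real n * ln (1 / \<delta>) \<le> real m"
      using m_int unfolding l_def by linarith
  next
    fix k x assume "k < m"
    have "real ((2 + \<kappa>\<^sub>0) * n + (3 * \<kappa> + 3) * Suc k) \<le> (2 + \<kappa>\<^sub>0) * real n + (3 * \<kappa> + 3) * real m"
      using \<open>k < m\<close> unfolding of_nat_add of_nat_mult
      by (intro add_mono mult_left_mono) auto
    also have "\<dots> \<le> (2 + \<kappa>\<^sub>0) * (l / l0) + (3 * \<kappa> + 3) * (l * (1 + 1 / l0))"
      using n m_le by (intro add_mono mult_left_mono) auto
    also have "\<dots> = C * l"
      by (simp add: C_def flip: l0_def) (simp add: algebra_simps)
    finally show "Run x (n + Suc k) ((2 + \<kappa>\<^sub>0) * n + (3 * \<kappa> + 3) * Suc k) \<in> ?S"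
      using \<open>k < m\<close> m_int by (simp add: l_def)
  qed
qed

end

text \<open>In the arithmetic bounds \<open>C\<close> is chosen before \<open>n\<close> and
  \<open>A\<close>, which expresses the O-notation; it may depend on the cost parameters and, in the
  tail bound, on \<open>\<delta>\<^sub>0\<close>.\<close>

theorem theorem4:
  fixes \<kappa>\<^sub>0 \<kappa> :: nat
  shows
    "(\<forall>n. \<forall>A \<in> carrier_mat n n. pos_semidef A \<longrightarrow> A \<noteq> 0\<^sub>m n n \<longrightarrow>
        lossless_spmf (rejection_sampler \<kappa>\<^sub>0 \<kappa> A) \<and>
        (\<forall>i<n. \<forall>j<n. spmf (map_spmf result (rejection_sampler \<kappa>\<^sub>0 \<kappa> A)) (i, j)
            = (A $$ (i, j))\<^sup>2 / (frobenius_norm A)\<^sup>2) \<and>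
        (\<forall>i<n. spmf (map_spmf (\<lambda>r. fst (result r)) (rejection_sampler \<kappa>\<^sub>0 \<kappa> A)) i
            = (euclidean_norm (col A i))\<^sup>2 / (frobenius_norm A)\<^sup>2) \<and>
        (\<forall>j<n. spmf (map_spmf (\<lambda>r. snd (result r)) (rejection_sampler \<kappa>\<^sub>0 \<kappa> A)) j
            = (euclidean_norm (col A j))\<^sup>2 / (frobenius_norm A)\<^sup>2) \<and>
        (\<integral>\<^sup>+ r. ennreal (real (queries r)) \<partial>measure_spmf (rejection_sampler \<kappa>\<^sub>0 \<kappa> A))
            \<le> ennreal (2 * real n)) \<and>
     (\<exists>C::real. \<forall>n. \<forall>A \<in> carrier_mat n n. pos_semidef A \<longrightarrow> A \<noteq> 0\<^sub>m n n \<longrightarrow>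
        (\<integral>\<^sup>+ r. ennreal (real (arith_ops r)) \<partial>measure_spmf (rejection_sampler \<kappa>\<^sub>0 \<kappa> A))
            \<le> ennreal (C * real n)) \<and>
     (\<forall>\<delta>\<^sub>0::real. 0 < \<delta>\<^sub>0 \<longrightarrow> \<delta>\<^sub>0 < 1 \<longrightarrow>
       (\<exists>C::real. \<forall>n. \<forall>A \<in> carrier_mat n n. pos_semidef A \<longrightarrow> A \<noteq> 0\<^sub>m n n \<longrightarrow>
        (\<forall>\<delta>. 0 < \<delta> \<longrightarrow> \<delta> \<le> \<delta>\<^sub>0 \<longrightarrow>
          1 - \<delta> \<le> measure (measure_spmf (rejection_sampler \<kappa>\<^sub>0 \<kappa> A))
            {r. real (queries r) \<le> real n + of_int \<lceil>real n * ln (1 / \<delta>)\<rceil> \<and>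
                real (arith_ops r) \<le> C * (real n * ln (1 / \<delta>))})))"
proof (intro conjI allI impI ballI exI)
  fix n and A :: "real mat"
  assume "A \<in> carrier_mat n n" "pos_semidef A" "A \<noteq> 0\<^sub>m n n"
  then interpret nonzero_psd A n
    by unfold_locales
  note map_result = map_result_rejection_sampler[of "\<lambda>x. x", simplified]
  show "lossless_spmf (rejection_sampler \<kappa>\<^sub>0 \<kappa> A)"
    by (rule lossless_rejection_sampler)
  show "spmf (map_spmf result (rejection_sampler \<kappa>\<^sub>0 \<kappa> A)) (i, j)
      = (A $$ (i, j))\<^sup>2 / (frobenius_norm A)\<^sup>2" if "i < n" "j < n" for i j
    using that by (simp add: map_result pmf_sq_pmf frobenius_norm_sq)
  show "spmf (map_spmf (\<lambda>r. fst (result r)) (rejection_sampler \<kappa>\<^sub>0 \<kappa> A)) i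
      = (euclidean_norm (col A i))\<^sup>2 / (frobenius_norm A)\<^sup>2" if "i < n" for i
    using that
    by (simp add: map_result_rejection_sampler pmf_map_fst_sq_pmf euclidean_norm_col_sq frobenius_norm_sq)
  show "spmf (map_spmf (\<lambda>r. snd (result r)) (rejection_sampler \<kappa>\<^sub>0 \<kappa> A)) j
      = (euclidean_norm (col A j))\<^sup>2 / (frobenius_norm A)\<^sup>2" if "j < n" for j
    using that
    by (simp add: map_result_rejection_sampler pmf_map_snd_sq_pmf euclidean_norm_col_sq frobenius_norm_sq)
  show "(\<integral>\<^sup>+ r. ennreal (real (queries r)) \<partial>measure_spmf (rejection_sampler \<kappa>\<^sub>0 \<kappa> A))
      \<le> ennreal (2 * real n)"
    by (rule expected_queries_le)
  show "(\<integral>\<^sup>+ r. ennreal (real (arith_ops r)) \<partial>measure_spmf (rejection_sampler \<kappa>\<^sub>0 \<kappa> A))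
      \<le> ennreal (real (5 + \<kappa>\<^sub>0 + 3 * \<kappa>) * real n)"
    using expected_arith_ops_le by simp
next
  fix \<delta>\<^sub>0 \<delta> :: real and n and A :: "real mat"
  assume "A \<in> carrier_mat n n" "pos_semidef A" "A \<noteq> 0\<^sub>m n n"
  then interpret nonzero_psd A n
    by unfold_locales
  assume "0 < \<delta>" "\<delta> \<le> \<delta>\<^sub>0" "\<delta>\<^sub>0 < 1"
  then show "1 - \<delta> \<le> measure (measure_spmf (rejection_sampler \<kappa>\<^sub>0 \<kappa> A))
      {r. real (queries r) \<le> real n + of_int \<lceil>real n * ln (1 / \<delta>)\<rceil> \<and>
          real (arith_ops r) \<le> ((2 + \<kappa>\<^sub>0) / ln (1 / \<delta>\<^sub>0) + (3 * \<kappa> + 3) * (1 + 1 / ln (1 / \<delta>\<^sub>0)))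
            * (real n * ln (1 / \<delta>))}"
    by (rule prob_within_budget)
qed

end
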